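(* For $1\leq p<\infty$, $p<q<\infty$ and $n\in\mathbb N$ let $$\widetilde{C}(p,q,n):=\bigg[\frac{q}{q-p}+2^{\frac{nq}{p}}+2^{(n+1)q}\,\Gamma(q+1)\,e^{b+q+1}\bigg]^{1/q}\quad\text{with}\quad b=\frac{1}{2^{\frac{n}{p'}+1}\cdot e}.$$ Then $\widetilde{C}(p,q,n)=\mathcal{O}(q)$ as $q\to\infty$. More precisely, for every $n\in\mathbb N$ there is a constant $C_n>0$ depending only on $n$ such that for every $p\in[1,\infty)$ the inequality $\widetilde{C}(p,q,n)\leq C_n\cdot q$ holds for all sufficiently large $q$.
   Context: $\Gamma$ is the gamma function, $e$ is the base of natural logarithms, and $p'$ is the conjugate exponent of $p$, $1/p+1/p'=1$ (so $n/p'=n-n/p$, which is $0$ when $p=1$). "Sufficiently large $q$" means all $q\ge q_0$ for some threshold $q_0>p$ that may depend on $p$ and $n$. The quantity $\widetilde{C}(p,q,n)$ is the constant in the interpolation inequality $\|f\|_{L^{q,\kappa}}\leq \widetilde{C}(p,q,n)\|f\|_{L^{p,\kappa}}^{p/q}\|f\|_{\mathrm{BMO}}^{1-p/q}$ between Morrey spaces and BMO, but the claim concerns only the explicit formula. *)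

theory Defs
  imports "HOL-Analysis.Gamma_Function" "HOL-Library.Landau_Symbols"
begin

(* The exponent n/p', with p' the conjugate exponent, is written as n * (1 - 1/p);
   this includes p = 1, where p' is infinite and n/p' = 0. *)
definition b_const :: "real \<Rightarrow> nat \<Rightarrow> real" where
  "b_const p n = 1 / (2 powr (real n * (1 - 1 / p) + 1) * exp 1)"

(* Only meaningful for 1 \<le> p < q. *)
definition C_tilde :: "real \<Rightarrow> real \<Rightarrow> nat \<Rightarrow> real" where
  "C_tilde p q n =
     (q / (q - p) + 2 powr (real n * q / p)
        + 2 powr ((real n + 1) * q) * Gamma (q + 1) * exp (b_const p n + q + 1)) powr (1 / q)"

end

theory Submission
  imports Defs
begin

text \<open>
  Every summand under the \<open>q\<close>-th root is at most the \<open>q\<close>-th power of a quantity linear in \<open>q\<close>.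
  The only summand that grows faster than exponentially is the one with the Gamma function, and
  \<open>\<Gamma>(q + 1) \<le> q\<^sup>q\<close> there suffices (\<open>Gamma_plus1_le_powr_self\<close>); the finer Stirling asymptotics would only improve the constant.
  The dependence on \<open>p\<close> disappears once \<open>q \<ge> 2p\<close>: then \<open>q / (q - p) \<le> 2\<close>,
  while \<open>p \<ge> 1\<close> gives \<open>nq/p \<le> nq\<close> and \<open>b \<le> 1\<close>. All three summands
  are then at most \<open>(2\<^bsup>n+1\<^esup> e\<^sup>3 q)\<^bsup>q\<^esup>\<close>, and their number \<open>3\<close> is at most \<open>3\<^bsup>q\<^esup>\<close>, so that
  \<open>C\<^sub>n = 3 \<cdot> 2\<^bsup>n+1\<^esup> e\<^sup>3\<close> works for all \<open>p\<close>, with threshold \<open>q\<^sub>0 = 2p\<close>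
  (\<open>C_tilde_le_linear\<close>). The first claim of the theorem is a consequence of this bound.
\<close>

text \<open>The logarithm of the Gamma function is convex and vanishes at both \<open>1\<close> and \<open>2\<close>.\<close>

lemma Gamma_le_1_between_1_2:
  fixes x :: real
  assumes "1 \<le> x" "x \<le> 2"
  shows "Gamma x \<le> 1"
proof -
  have "(ln \<circ> Gamma) ((1 - (x - 1)) *\<^sub>R 1 + (x - 1) *\<^sub>R 2)
      \<le> (1 - (x - 1)) * (ln \<circ> Gamma) 1 + (x - 1) * (ln \<circ> Gamma) (2::real)"
    by (rule convex_onD[OF log_convex_Gamma_real]) (use assms in auto)
  moreover have "(1 - (x - 1)) *\<^sub>R 1 + (x - 1) *\<^sub>R 2 = x"
    by (simp add: algebra_simps)
  moreover have "Gamma (2::real) = 1"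
    using Gamma_fact[of 1, where 'a = real] by simp
  ultimately have "ln (Gamma x) \<le> 0"
    by simp
  moreover have "Gamma x > 0"
    using assms by (simp add: Gamma_real_pos)
  ultimately show ?thesis
    by simp
qed

text \<open>
  Induction along \<open>x \<mapsto> x + 1\<close>: passing to \<open>x + 1\<close> multiplies the left-hand side by \<open>x + 1\<close>
  and the right-hand side by at least as much. The start is the interval \<open>[1, 2]\<close>, where
  \<open>\<Gamma>(x + 1) = x \<Gamma>(x) \<le> x \<le> x\<^sup>x\<close>.
\<close>

lemma Gamma_plus1_le_powr_self:
  fixes x :: real
  assumes "1 \<le> x"
  shows "Gamma (x + 1) \<le> x powr x"
proof -
  have "\<And>x::real. 1 \<le> x \<Longrightarrow> x \<le> real m + 2 \<Longrightarrow> Gamma (x + 1) \<le> x powr x" for m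
  proof (induction m)
    case 0
    have "Gamma (x + 1) = x * Gamma x"
      using 0 by (intro Gamma_plus1) (auto elim: nonpos_Ints_cases)
    also have "\<dots> \<le> x * 1"
      using 0 Gamma_le_1_between_1_2[of x] by (intro mult_left_mono) auto
    also have "\<dots> = x powr 1"
      using 0 by simp
    also have "\<dots> \<le> x powr x"
      using 0 by (intro powr_mono) auto
    finally show ?case .
  next
    case (Suc m)
    show ?case
    proof (cases "x \<le> real m + 2")
      case True
      then show ?thesis using Suc by blast
    next
      case False
      then have x: "x \<ge> 2" by simp
      have "Gamma (x + 1) = x * Gamma x"
        using x by (intro Gamma_plus1) (auto elim: nonpos_Ints_cases)
      also have "Gamma x \<le> (x - 1) powr (x - 1)"
        using Suc.IH[of "x - 1"] Suc.prems x by simp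
      also have "(x - 1) powr (x - 1) \<le> x powr (x - 1)"
        using x by (intro powr_mono2) auto
      also have "x * x powr (x - 1) = x powr x"
        using x by (simp add: powr_mult_base)
      finally show ?thesis
        using x by simp
    qed
  qed
  from this[of x "nat \<lceil>x\<rceil>"] show ?thesis
    using assms by linarith
qed

lemma b_const_le_1:
  assumes "1 \<le> p"
  shows "b_const p n \<le> 1"
proof -
  have "1 \<le> (2::real) powr (real n * (1 - 1 / p) + 1)"
    using assms by (intro ge_one_powr_ge_zero) auto
  moreover have "1 \<le> exp (1::real)"
    by simp
  ultimately have "1 * 1 \<le> 2 powr (real n * (1 - 1 / p) + 1) * exp (1::real)"
    by (intro mult_mono) auto
  then show ?thesis
    by (simp add: b_const_def divide_le_eq)
qed

lemma C_tilde_le_linear: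
  fixes p q :: real
  assumes p: "1 \<le> p" and q: "2 * p \<le> q"
  shows "C_tilde p q n \<le> 3 * (2 ^ (n + 1) * exp 3) * q"
proof -
  define K :: real where "K = 2 ^ (n + 1) * exp 3"
  have q2: "q \<ge> 2"
    using p q by simp
  have K_q: "K powr q = 2 powr ((real n + 1) * q) * exp (3 * q)"
  proof -
    have "K = 2 powr (real n + 1) * exp 3"
      by (simp add: K_def powr_add powr_realpow)
    then show ?thesis
      by (simp add: powr_mult exp_powr_real powr_powr)
  qed
  have Kq_ge: "2 powr ((real n + 1) * q) \<le> (K * q) powr q"
  proof -
    have "2 powr ((real n + 1) * q) * 1 * 1 \<le> 2 powr ((real n + 1) * q) * exp (3 * q) * q powr q"
      using q2 by (intro mult_mono ge_one_powr_ge_zero) auto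
    also have "\<dots> = (K * q) powr q"
      using q2 by (simp add: powr_mult K_q K_def[symmetric])
    finally show ?thesis by simp
  qed
  have 1: "q / (q - p) \<le> (K * q) powr q"
  proof -
    have "q / (q - p) \<le> 2 powr 1"
      using p q by (simp add: divide_le_eq)
    also have "\<dots> \<le> 2 powr ((real n + 1) * q)"
      using q2 mult_mono[of 1 "real n + 1" 1 q] by (intro powr_mono) auto
    finally show ?thesis
      using Kq_ge by simp
  qed
  have 2: "2 powr (real n * q / p) \<le> (K * q) powr q"
  proof -
    have "real n * q / p \<le> real n * q / 1"
      using p q2 by (intro divide_left_mono) auto
    also have "\<dots> \<le> (real n + 1) * q"
      using q2 by (simp add: algebra_simps)
    finally have "2 powr (real n * q / p) \<le> (2::real) powr ((real n + 1) * q)"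
      by (intro powr_mono) auto
    then show ?thesis
      using Kq_ge by (rule order_trans)
  qed
  have 3: "2 powr ((real n + 1) * q) * Gamma (q + 1) * exp (b_const p n + q + 1) \<le> (K * q) powr q"
  proof -
    have "2 powr ((real n + 1) * q) * Gamma (q + 1) * exp (b_const p n + q + 1)
        \<le> 2 powr ((real n + 1) * q) * q powr q * exp (3 * q)"
      using q2 b_const_le_1[OF p, of n] Gamma_plus1_le_powr_self[of q]
      by (intro mult_mono) auto
    also have "\<dots> = (K * q) powr q"
      using q2 by (simp add: powr_mult K_q)
    finally show ?thesis .
  qed
  have "0 \<le> q / (q - p)"
    using p q by simp
  moreover have "0 \<le> Gamma (q + 1)"
    using q2 by (intro less_imp_le Gamma_real_pos) auto
  ultimately have "C_tilde p q n \<le> (3 * (K * q) powr q) powr (1 / q)"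
    unfolding C_tilde_def using 1 2 3 q2 by (intro powr_mono2 add_nonneg_nonneg) auto
  also have "\<dots> \<le> (3 powr q * (K * q) powr q) powr (1 / q)"
  proof -
    have "3 powr 1 \<le> (3::real) powr q"
      using q2 by (intro powr_mono) auto
    then show ?thesis
      using q2 by (intro powr_mono2 mult_right_mono) auto
  qed
  also have "\<dots> = 3 * K * q"
  proof -
    have "K > 0"
      by (simp add: K_def)
    then show ?thesis
      using q2 by (simp add: powr_powr flip: powr_mult)
  qed
  finally show ?thesis
    by (simp add: K_def)
qed

theorem mainTheorem4:
  fixes n :: nat
  assumes "n \<ge> 1"
  shows "(\<forall>p::real. p \<ge> 1 \<longrightarrow> (\<lambda>q::real. C_tilde p q n) \<in> O[at_top](\<lambda>q. q)) \<and>
         (\<exists>C::real. C > 0 \<and>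
            (\<forall>p::real. p \<ge> 1 \<longrightarrow>
               (\<exists>q0::real. q0 > p \<and> (\<forall>q::real. q \<ge> q0 \<longrightarrow> C_tilde p q n \<le> C * q))))"
proof (intro conjI allI impI)
  fix p :: real
  assume p: "p \<ge> 1"
  have "norm (C_tilde p q n) \<le> 3 * (2 ^ (n + 1) * exp 3) * norm q" if "q \<ge> 2 * p" for q
    using C_tilde_le_linear[OF p that, of n] p that by (simp add: C_tilde_def)
  then show "(\<lambda>q::real. C_tilde p q n) \<in> O[at_top](\<lambda>q. q)"
    by (intro bigoI[where c = "3 * (2 ^ (n + 1) * exp 3)"] eventually_at_top_linorderI)
next
  show "\<exists>C::real. C > 0 \<and>
          (\<forall>p::real. p \<ge> 1 \<longrightarrow>
             (\<exists>q0::real. q0 > p \<and> (\<forall>q::real. q \<ge> q0 \<longrightarrow> C_tilde p q n \<le> C * q)))"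
  proof (rule exI[where x = "3 * (2 ^ (n + 1) * exp 3)"], intro conjI allI impI)
    fix p :: real
    assume p: "p \<ge> 1"
    show "\<exists>q0>p. \<forall>q\<ge>q0. C_tilde p q n \<le> 3 * (2 ^ (n + 1) * exp 3) * q"
      using p C_tilde_le_linear[OF p] by (intro exI[where x = "2 * p"]) auto
  qed simp
qed

end
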